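(* Let $d\geq 1$, let $Q=\{x\in\mathbb{R}^d:x_i\geq 0\ \text{for all } 1\leq i\leq d\}$, let $v$ be a fixed vector in the interior of $Q$, and let $\mathfrak{S}\subset\mathbb{R}^d$ be a finite set of steps such that: (i) $\mathfrak{S}$ is not included in a linear hyperplane of $\mathbb{R}^d$; (ii) $\mathfrak{S}$ is not included in a half-space $u^-=\{y\in\mathbb{R}^d:\langle u,y\rangle\leq 0\}$ with $u\in Q\setminus\{0\}$. Then the Laplace transform of $\mathfrak{S}$, $$L_{\mathfrak{S}}(x):=\sum_{s\in\mathfrak{S}}e^{\langle x,s\rangle},$$ reaches a global minimum on $Q$ at a unique point $x_0$, and there exists $\delta\geq 0$ such that for any starting point $x\in Q_\delta$, $$\lim_{n\to\infty}f_{\mathfrak{S}}(x;n)^{1/n}=L_{\mathfrak{S}}(x_0).$$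
   Context: $\langle\cdot,\cdot\rangle$ is the standard inner product on $\mathbb{R}^d$. For $\delta\in\mathbb{R}$, $Q_\delta=Q+\delta v$. For $x\in Q$ and $n\geq 0$, $f_{\mathfrak{S}}(x;n)$ denotes the total number of $\mathfrak{S}$-walks of length $n$ starting at $x$ and confined to $Q$, with arbitrary endpoint, i.e. the number of sequences $(s_1,\dots,s_n)\in\mathfrak{S}^n$ such that $x+s_1+\cdots+s_k\in Q$ for all $1\leq k\leq n$. *)

theory Defs
  imports "HOL-Analysis.Analysis"
begin

definition orthant :: "(real ^ 'd) set" where
  "orthant = {x. \<forall>i. 0 \<le> x $ i}"

definition shifted_orthant :: "real ^ 'd \<Rightarrow> real \<Rightarrow> (real ^ 'd) set" where
  "shifted_orthant v \<delta> = (\<lambda>y. y + \<delta> *\<^sub>R v) ` orthant"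

definition neg_half_space :: "real ^ 'd \<Rightarrow> (real ^ 'd) set" where
  "neg_half_space u = {y. u \<bullet> y \<le> 0}"

definition linear_hyperplane :: "(real ^ 'd) set \<Rightarrow> bool" where
  "linear_hyperplane H \<longleftrightarrow> (\<exists>u. u \<noteq> 0 \<and> H = {y. u \<bullet> y = 0})"

text \<open>A walk is encoded by its list of steps. Since the number of walks is taken with
  \<open>card\<close>, it is meaningful only for finite \<open>S\<close>.\<close>

definition confined_walks ::
    "(real ^ 'd) set \<Rightarrow> real ^ 'd \<Rightarrow> nat \<Rightarrow> (real ^ 'd) list set" where
  "confined_walks S x n =
     {w. length w = n \<and> set w \<subseteq> S \<and> (\<forall>k\<in>{1..n}. x + sum_list (take k w) \<in> orthant)}"

definition num_walks :: "(real ^ 'd) set \<Rightarrow> real ^ 'd \<Rightarrow> nat \<Rightarrow> nat" where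
  "num_walks S x n = card (confined_walks S x n)"

definition laplace :: "(real ^ 'd) set \<Rightarrow> real ^ 'd \<Rightarrow> real" where
  "laplace S x = (\<Sum>s\<in>S. exp (x \<bullet> s))"

end

theory Submission
  imports Defs
begin

text \<open>
  Write \<open>Q\<close> for the orthant, \<open>L\<close> for the Laplace transform and \<open>l\<close> for its minimum on \<open>Q\<close>.

  The minimum exists because hypothesis (ii), by compactness of the set of unit vectors of \<open>Q\<close>,
  makes \<open>L\<close> grow at least linearly on \<open>Q\<close> (\<open>laplace_linear_growth\<close>). It is attained once
  because hypothesis (i) makes \<open>L\<close> strictly convex (\<open>laplace_arg_min_unique\<close>).

  The growth rate is at most \<open>l\<close>: if \<open>z\<close> lies in \<open>Q\<close>, then \<open>exp (z \<bullet> y) \<ge> 1\<close> at every endpoint \<open>y\<close> of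
  a confined walk, and summing this exponential over all walks, confined or not, gives
  \<open>exp (z \<bullet> x) * L z ^ n\<close> (\<open>num_walks_le\<close>).

  It is at least \<open>l\<close> because for each \<open>\<epsilon> > 0\<close> there are a length \<open>k\<close> and at least
  \<open>(l * exp (- \<epsilon>)) ^ k\<close> words of length \<open>k\<close>, called blocks, whose sums have positive coordinates
  (\<open>many_blocks\<close>). To find them, draw steps independently with probability proportional to
  \<open>exp (z \<bullet> s)\<close>; the mean step is \<open>m = \<nabla>L(z) / L(z)\<close>. At the minimum of \<open>L\<close> on \<open>Q\<close>, the first-order
  conditions say that \<open>m \<in> Q\<close> and \<open>z \<bullet> m = 0\<close>, but \<open>m\<close> may have zero coordinates, and then typical
  walks leave \<open>Q\<close>. So \<open>z\<close> is chosen instead as a minimum point of \<open>y \<mapsto> L(y) - b \<bullet> y\<close>, where all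
  coordinates of \<open>b\<close> equal a small \<open>\<eta> > 0\<close>. The first-order conditions now read \<open>m\<^sub>i \<ge> \<eta> / L(z)\<close> and
  \<open>z \<bullet> m \<le> (b \<bullet> z) / L(z)\<close> (\<open>laplace_grad_variational\<close>), so the drift points into the interior of
  \<open>Q\<close> and \<open>z \<bullet> m\<close> is still small, as \<open>z\<close> stays bounded when \<open>\<eta>\<close> tends to 0. By the weak law of
  large numbers (\<open>words_weak_law\<close>), words with sum close to \<open>k m\<close> carry at least half of the probability.
  Each of them has probability \<open>exp (z \<bullet> sum) / L(z) ^ k\<close>, which is about
  \<open>exp (k (z \<bullet> m)) / L(z) ^ k\<close>, so there are many of them.

  A walk made of blocks stays in \<open>Q\<close> as soon as it starts deep enough for each single block to do so,
  since every finished block moves it further in (\<open>num_walks_blocks\<close>). How deep depends on \<open>\<epsilon>\<close>,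
  whereas \<open>\<delta>\<close> may not. Therefore \<open>\<delta>\<close> is chosen for one fixed word \<open>w\<close> whose sum has positive
  coordinates: from any point of \<open>Q + \<delta> v\<close>, repeating \<open>w\<close> leads to any required depth in a bounded
  number of steps (\<open>num_walks_repeat\<close>), which does not affect the growth rate.
\<close>

section \<open>The orthant\<close>

lemma orthant_add: "x \<in> orthant \<Longrightarrow> y \<in> orthant \<Longrightarrow> x + y \<in> orthant"
  by (simp add: orthant_def)

lemma orthant_scaleR: "0 \<le> t \<Longrightarrow> x \<in> orthant \<Longrightarrow> t *\<^sub>R x \<in> orthant"
  by (simp add: orthant_def)

lemma zero_in_orthant: "0 \<in> orthant"
  by (simp add: orthant_def)

lemma inner_orthant_nonneg: "x \<in> orthant \<Longrightarrow> y \<in> orthant \<Longrightarrow> 0 \<le> x \<bullet> y"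
  by (auto simp: orthant_def inner_vec_def intro!: sum_nonneg)

lemma closed_orthant: "closed (orthant :: (real ^ 'd) set)"
  unfolding orthant_def by (intro closed_Collect_all closed_Collect_le continuous_intros)

lemma interior_orthant_component_pos:
  assumes "v \<in> interior orthant"
  shows "0 < v $ i"
proof -
  obtain e where e: "e > 0" "ball v e \<subseteq> orthant"
    using assms by (auto simp: mem_interior)
  have "v - (e / 2) *\<^sub>R axis i 1 \<in> ball v e"
    using e by (simp add: dist_norm)
  then have "v - (e / 2) *\<^sub>R axis i 1 \<in> orthant"
    using e(2) by blast
  then have "0 \<le> (v - (e / 2) *\<^sub>R axis i 1) $ i"
    unfolding orthant_def by blast
  then show ?thesis
    using e by (simp add: axis_def)
qed

lemma positive_direction_absorbs:
  fixes u :: "real ^ 'd"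
  assumes u: "\<And>i. 0 < u $ i" and "finite A"
  shows "\<exists>D\<ge>0. \<forall>a\<in>A. \<forall>t\<ge>D. a + t *\<^sub>R u \<in> orthant"
proof -
  define D where "D = (\<Sum>a\<in>A. \<Sum>i\<in>UNIV. \<bar>a $ i\<bar> / u $ i)"
  have nn: "0 \<le> \<bar>a $ i\<bar> / u $ i" for a :: "real ^ 'd" and i
    using u[of i] by simp
  have "D \<ge> 0"
    unfolding D_def by (intro sum_nonneg nn)
  moreover have "a + t *\<^sub>R u \<in> orthant" if "a \<in> A" "t \<ge> D" for a t
  proof -
    have "0 \<le> (a + t *\<^sub>R u) $ i" for i
    proof -
      have "\<bar>a $ i\<bar> / u $ i \<le> (\<Sum>i\<in>UNIV. \<bar>a $ i\<bar> / u $ i)"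
        by (rule member_le_sum) (auto intro: nn)
      also have "\<dots> \<le> D"
        unfolding D_def using that(1) assms(2)
        by (intro member_le_sum[of a A "\<lambda>a. \<Sum>i\<in>UNIV. \<bar>a $ i\<bar> / u $ i"] sum_nonneg nn)
      finally have "\<bar>a $ i\<bar> \<le> t * u $ i"
        using that(2) u[of i] by (simp add: divide_le_eq) (meson dual_order.trans mult_right_mono less_imp_le)
      then show ?thesis by simp
    qed
    then show ?thesis by (simp add: orthant_def)
  qed
  ultimately show ?thesis by blast
qed

section \<open>Weighted sums over words\<close>

definition words :: "'a set \<Rightarrow> nat \<Rightarrow> 'a list set" where
  "words S k = {w. set w \<subseteq> S \<and> length w = k}"

lemma finite_words: "finite S \<Longrightarrow> finite (words S k)"
  unfolding words_def by (rule finite_lists_length_eq)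

lemma words_0: "words S 0 = {[]}"
  by (auto simp: words_def)

lemma sum_words_Suc: "(\<Sum>w\<in>words S (Suc k). f w) = (\<Sum>s\<in>S. \<Sum>w\<in>words S k. f (s # w))"
proof -
  have "(\<Sum>w\<in>words S (Suc k). f w) = (\<Sum>(s, w)\<in>S \<times> words S k. f (s # w))"
    by (rule sum.reindex_bij_witness[of _ "\<lambda>(s, w). s # w" "\<lambda>w. (hd w, tl w)"])
       (auto simp: words_def length_Suc_conv)
  then show ?thesis by (simp add: sum.cartesian_product)
qed

lemma sum_words_prod_list:
  fixes f :: "'a \<Rightarrow> real"
  shows "(\<Sum>w\<in>words S k. prod_list (map f w)) = sum f S ^ k"
  by (induction k) (simp_all add: words_0 sum_words_Suc sum_product flip: sum_distrib_left sum_distrib_right)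

lemma prod_list_exp_inner:
  fixes z :: "'a::real_inner"
  shows "prod_list (map (\<lambda>s. exp (z \<bullet> s) / c) w) = exp (z \<bullet> sum_list w) / c ^ length w"
  by (induction w) (simp_all add: inner_add_right exp_add)

lemma sum_words_centred:
  fixes S :: "'a::real_inner set"
  assumes p: "sum p S = 1" and m: "(\<Sum>s\<in>S. p s *\<^sub>R s) = m"
  shows "(\<Sum>w\<in>words S k. prod_list (map p w) *\<^sub>R (sum_list w - real k *\<^sub>R m)) = 0"
proof (induction k)
  case 0
  show ?case by (simp add: words_0)
next
  case (Suc k)
  let ?P = "\<lambda>w. prod_list (map p w)" and ?X = "\<lambda>w. sum_list w - real k *\<^sub>R m"
  have tot: "(\<Sum>w\<in>words S k. ?P w) = 1"
    by (simp add: sum_words_prod_list p)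
  have "(\<Sum>w\<in>words S (Suc k). ?P w *\<^sub>R (sum_list w - real (Suc k) *\<^sub>R m))
      = (\<Sum>s\<in>S. \<Sum>w\<in>words S k. ?P w *\<^sub>R (p s *\<^sub>R (s - m)) + p s *\<^sub>R (?P w *\<^sub>R ?X w))"
    unfolding sum_words_Suc by (intro sum.cong refl) (simp add: algebra_simps)
  also have "\<dots> = (\<Sum>s\<in>S. p s *\<^sub>R (s - m))"
    by (simp only: sum.distrib Suc tot scaleR_one scaleR_zero_right sum.neutral_const add_0_right
        flip: scaleR_sum_left scaleR_sum_right)
  also have "\<dots> = 0"
    using p m by (simp add: scaleR_diff_right sum_subtractf flip: scaleR_sum_left)
  finally show ?case .
qed

text \<open>The variance of a sum of \<open>k\<close> independent steps is \<open>k\<close> times that of one step: splitting off the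
  first step, the cross term is an inner product with a centred sum and vanishes.\<close>

lemma sum_words_variance:
  fixes S :: "'a::real_inner set"
  assumes p: "sum p S = 1" and m: "(\<Sum>s\<in>S. p s *\<^sub>R s) = m"
  shows "(\<Sum>w\<in>words S k. prod_list (map p w) * (norm (sum_list w - real k *\<^sub>R m))\<^sup>2)
       = real k * (\<Sum>s\<in>S. p s * (norm (s - m))\<^sup>2)"
proof (induction k)
  case 0
  show ?case by (simp add: words_0)
next
  case (Suc k)
  let ?P = "\<lambda>w. prod_list (map p w)" and ?X = "\<lambda>w. sum_list w - real k *\<^sub>R m"
  have tot: "(\<Sum>w\<in>words S k. ?P w) = 1"
    by (simp add: sum_words_prod_list p)
  have sq: "(norm (sum_list (s # w) - real (Suc k) *\<^sub>R m))\<^sup>2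
      = (norm (s - m))\<^sup>2 + 2 * ((s - m) \<bullet> ?X w) + (norm (?X w))\<^sup>2" for s w
  proof -
    have eq: "sum_list (s # w) - real (Suc k) *\<^sub>R m = (s - m) + ?X w"
      by (simp add: algebra_simps)
    show ?thesis unfolding eq power2_norm_eq_inner
      by (simp add: inner_add_left inner_add_right inner_commute)
  qed
  have inner: "(\<Sum>w\<in>words S k. ?P (s # w) * (norm (sum_list (s # w) - real (Suc k) *\<^sub>R m))\<^sup>2)
     = p s * (norm (s - m))\<^sup>2 + p s * (\<Sum>w\<in>words S k. ?P w * (norm (?X w))\<^sup>2)" for s
  proof -
    have "(\<Sum>w\<in>words S k. ?P (s # w) * (norm (sum_list (s # w) - real (Suc k) *\<^sub>R m))\<^sup>2)
      = (\<Sum>w\<in>words S k. ?P w * (p s * (norm (s - m))\<^sup>2)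
          + (2 * p s) * ((s - m) \<bullet> (?P w *\<^sub>R ?X w)) + p s * (?P w * (norm (?X w))\<^sup>2))"
      unfolding sq by (intro sum.cong refl) (simp add: algebra_simps)
    also have "\<dots> = p s * (norm (s - m))\<^sup>2
          + (2 * p s) * ((s - m) \<bullet> (\<Sum>w\<in>words S k. ?P w *\<^sub>R ?X w))
          + p s * (\<Sum>w\<in>words S k. ?P w * (norm (?X w))\<^sup>2)"
      by (simp add: sum.distrib inner_sum_right sum_distrib_left tot flip: sum_distrib_right)
    finally show ?thesis
      by (simp add: sum_words_centred[OF p m])
  qed
  show ?case
    unfolding sum_words_Suc[of _ S k] inner Suc
    by (simp add: sum.distrib p algebra_simps flip: sum_distrib_right sum_distrib_left)
qed

text \<open>Chebyshev's inequality for \<open>k\<close> independent steps with law \<open>p\<close>, where words of length \<open>k\<close> carry the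
  product weights.\<close>

lemma words_weak_law:
  fixes S :: "'a::real_inner set"
  assumes fin: "finite S" and p0: "\<And>s. s \<in> S \<Longrightarrow> 0 \<le> p s" and p: "sum p S = 1"
    and m: "(\<Sum>s\<in>S. p s *\<^sub>R s) = m" and "r > 0"
  shows "\<forall>\<^sub>F k in sequentially.
    1/2 \<le> (\<Sum>w\<in>{w \<in> words S k. norm (sum_list w - real k *\<^sub>R m) \<le> real k * r}. prod_list (map p w))"
proof -
  define V where "V = (\<Sum>s\<in>S. p s * (norm (s - m))\<^sup>2)"
  have "\<forall>\<^sub>F k in sequentially. 2 * V / r\<^sup>2 \<le> real k \<and> 0 < k"
    by (intro eventually_conj eventually_gt_at_top)
       (meson eventually_sequentiallyI le_nat_iff nat_ceiling_le_eq)
  then show ?thesis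
  proof eventually_elim
    case (elim k)
    let ?P = "\<lambda>w. prod_list (map p w)" and ?N = "\<lambda>w. norm (sum_list w - real k *\<^sub>R m)"
    let ?G = "{w \<in> words S k. ?N w \<le> real k * r}"
    have P0: "0 \<le> ?P w" if "w \<in> words S k" for w
      using that p0 by (intro prod_list_nonneg) (auto simp: words_def)
    have kr: "0 < real k * r" using elim \<open>r > 0\<close> by simp
    have "(real k * r)\<^sup>2 * (\<Sum>w\<in>words S k - ?G. ?P w) \<le> (\<Sum>w\<in>words S k - ?G. ?P w * (?N w)\<^sup>2)"
      unfolding sum_distrib_left
    proof (rule sum_mono)
      fix w assume w: "w \<in> words S k - ?G"
      then have "(real k * r)\<^sup>2 \<le> (?N w)\<^sup>2"
        using kr by (intro power_mono) auto
      with P0[of w] w show "(real k * r)\<^sup>2 * ?P w \<le> ?P w * (?N w)\<^sup>2"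
        by (simp add: mult.commute mult_left_mono)
    qed
    also have "\<dots> \<le> (\<Sum>w\<in>words S k. ?P w * (?N w)\<^sup>2)"
      using P0 by (intro sum_mono2 finite_words fin) auto
    also have "\<dots> = real k * V"
      unfolding V_def by (rule sum_words_variance[OF p m])
    also have "\<dots> \<le> real k * (real k * r\<^sup>2 / 2)"
      using elim \<open>r > 0\<close> by (intro mult_left_mono) (auto simp: field_simps)
    also have "\<dots> = (real k * r)\<^sup>2 * (1/2)"
      by (simp add: power2_eq_square)
    finally have "(\<Sum>w\<in>words S k - ?G. ?P w) \<le> 1/2"
      using kr by (simp only: mult_le_cancel_left_pos zero_less_power)
    moreover have "(\<Sum>w\<in>words S k - ?G. ?P w) = (\<Sum>w\<in>words S k. ?P w) - (\<Sum>w\<in>?G. ?P w)"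
      by (intro sum_diff finite_words fin) auto
    ultimately show ?case
      by (simp add: sum_words_prod_list p)
  qed
qed

section \<open>Minimising the Laplace transform on the orthant\<close>

lemma continuous_on_laplace: "continuous_on A (laplace S)"
  unfolding laplace_def by (intro continuous_intros)

text \<open>By hypothesis (ii), each unit vector \<open>z\<close> of the orthant has a step with \<open>z \<bullet> s > 0\<close>, so the
  positively homogeneous function \<open>\<Sum>s\<in>S. max 0 (z \<bullet> s)\<close> has a positive minimum on the compact
  set of these vectors. It lies below \<open>laplace S\<close> because \<open>max 0 t \<le> exp t\<close>.\<close>

lemma laplace_linear_growth:
  fixes S :: "(real ^ 'd) set"
  assumes "finite S" and ii: "\<not> (\<exists>u \<in> orthant - {0}. S \<subseteq> neg_half_space u)"
  shows "\<exists>c>0. \<forall>z\<in>orthant. c * norm z \<le> laplace S z"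
proof -
  define h where "h z = (\<Sum>s\<in>S. max 0 (z \<bullet> s))" for z :: "real ^ 'd"
  let ?K = "orthant \<inter> sphere 0 1 :: (real ^ 'd) set"
  have pos: "0 < h z" if "z \<in> ?K" for z
  proof -
    have "z \<in> orthant - {0}" using that by auto
    then obtain s where "s \<in> S" "0 < z \<bullet> s"
      using ii by (auto simp: neg_half_space_def not_le subset_eq)
    then show ?thesis
      unfolding h_def using assms(1) by (intro sum_pos2[of S s]) auto
  qed
  have "axis undefined 1 \<in> ?K"
    by (simp add: orthant_def norm_axis_1) (simp add: axis_def)
  then have "?K \<noteq> {}" by blast
  moreover have "compact ?K"
    by (intro closed_Int_compact closed_orthant compact_sphere)
  moreover have "continuous_on ?K h"
    unfolding h_def by (intro continuous_intros)
  ultimately obtain y where y: "y \<in> ?K" "\<And>z. z \<in> ?K \<Longrightarrow> h y \<le> h z"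
    by (meson continuous_attains_inf)
  have "h y * norm z \<le> laplace S z" if z: "z \<in> orthant" for z
  proof (cases "z = 0")
    case True
    then show ?thesis by (simp add: laplace_def)
  next
    case False
    let ?n = "z /\<^sub>R norm z"
    have "?n \<in> ?K"
      using z False by (auto intro!: orthant_scaleR)
    then have "h y * norm z \<le> h ?n * norm z"
      by (intro mult_right_mono y) auto
    also have "\<dots> = h z"
    proof -
      have "max 0 (?n \<bullet> s) * norm z = max 0 (z \<bullet> s)" for s
        using False by (simp add: max_def field_simps zero_le_mult_iff zero_le_divide_iff)
      then show ?thesis unfolding h_def sum_distrib_right by simp
    qed
    also have "\<dots> \<le> laplace S z"
      unfolding h_def laplace_def
    proof (intro sum_mono max.boundedI)
      show "z \<bullet> s \<le> exp (z \<bullet> s)" for s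
        using exp_ge_add_one_self[of "z \<bullet> s"] by linarith
    qed auto
    finally show ?thesis .
  qed
  then show ?thesis using pos[OF y(1)] by blast
qed

text \<open>Linear growth survives a linear perturbation of at most half its slope, so the perturbed
  function is coercive. The bound on the minimum point does not depend on \<open>b\<close>, since the value
  at 0 is always \<open>card S\<close>.\<close>

lemma tilted_laplace_has_minimum:
  fixes S :: "(real ^ 'd) set"
  assumes c: "c > 0" "\<And>z. z \<in> orthant \<Longrightarrow> c * norm z \<le> laplace S z" and b: "norm b \<le> c / 2"
  shows "\<exists>z\<in>orthant. (\<forall>y\<in>orthant. laplace S z - b \<bullet> z \<le> laplace S y - b \<bullet> y)
      \<and> norm z \<le> 2 * real (card S) / c"
proof -
  define F where "F z = laplace S z - b \<bullet> z" for z
  define R where "R = 2 * real (card S) / c"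
  have lower: "c / 2 * norm z \<le> F z" if "z \<in> orthant" for z
  proof -
    have "b \<bullet> z \<le> norm b * norm z" by (rule norm_cauchy_schwarz)
    also have "\<dots> \<le> c / 2 * norm z" by (intro mult_right_mono b) auto
    finally show ?thesis using c(2)[OF that] by (simp add: F_def)
  qed
  have F0: "F 0 = real (card S)" by (simp add: F_def laplace_def)
  have small: "norm z \<le> R" if "z \<in> orthant" "F z \<le> F 0" for z
    using lower[OF that(1)] that(2) F0 c(1) by (simp add: R_def field_simps)
  let ?K = "orthant \<inter> cball 0 R :: (real ^ 'd) set"
  have 0: "0 \<in> ?K" using c(1) by (simp add: zero_in_orthant R_def)
  have "compact ?K" by (intro closed_Int_compact closed_orthant compact_cball)
  moreover have "continuous_on ?K F"
    unfolding F_def by (intro continuous_intros continuous_on_laplace)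
  ultimately obtain z where z: "z \<in> ?K" "\<And>y. y \<in> ?K \<Longrightarrow> F z \<le> F y"
    using 0 continuous_attains_inf[of ?K F] by blast
  have "F z \<le> F y" if "y \<in> orthant" for y
  proof (cases "F y \<le> F 0")
    case True
    then show ?thesis using small[OF that] that by (intro z) auto
  next
    case False
    then show ?thesis using z(2)[OF 0] by linarith
  qed
  then show ?thesis using z(1) unfolding F_def R_def by auto
qed

text \<open>This is the gradient of \<^term>\<open>laplace S\<close> at \<open>z\<close>.\<close>

definition laplace_grad :: "(real ^ 'd) set \<Rightarrow> real ^ 'd \<Rightarrow> real ^ 'd" where
  "laplace_grad S z = (\<Sum>s\<in>S. exp (z \<bullet> s) *\<^sub>R s)"

text \<open>First-order condition at a constrained minimum. It is used with \<open>h\<close> a basis vector, to bound the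
  coordinates of the gradient from below, and with \<open>h = - z\<close>, to bound its inner product with \<open>z\<close>.\<close>

lemma laplace_grad_variational:
  fixes S :: "(real ^ 'd) set"
  assumes min: "\<And>y. y \<in> orthant \<Longrightarrow> laplace S z - b \<bullet> z \<le> laplace S y - b \<bullet> y"
    and ray: "\<And>t. 0 < t \<Longrightarrow> t < 1 \<Longrightarrow> z + t *\<^sub>R h \<in> orthant"
  shows "b \<bullet> h \<le> laplace_grad S z \<bullet> h"
proof (rule ccontr)
  assume neg: "\<not> b \<bullet> h \<le> laplace_grad S z \<bullet> h"
  define F where "F t = laplace S (z + t *\<^sub>R h) - b \<bullet> (z + t *\<^sub>R h)" for t
  have "(F has_real_derivative (laplace_grad S z \<bullet> h - b \<bullet> h)) (at 0)"
    unfolding F_def laplace_def laplace_grad_def inner_add_left inner_add_right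
      inner_scaleR_left inner_scaleR_right inner_sum_left
    by (auto intro!: derivative_eq_intros simp: inner_commute)
  from DERIV_neg_dec_right[OF this] neg obtain d where
    d: "d > 0" "\<And>t. t > 0 \<Longrightarrow> t < d \<Longrightarrow> F (0 + t) < F 0" by auto
  define t where "t = min (d / 2) (1 / 2)"
  have t: "0 < t" "t < d" "t < 1" using d(1) by (auto simp: t_def)
  have "F 0 \<le> F t" using min[OF ray[OF t(1,3)]] by (simp add: F_def)
  with d(2)[OF t(1,2)] show False by simp
qed

text \<open>At the midpoint of two points \<open>x\<close> and \<open>y\<close>, convexity of \<open>t \<mapsto> exp t\<close> is strict for each step with
  \<open>x \<bullet> s \<noteq> y \<bullet> s\<close>; such a step exists since the steps do not all lie in the hyperplane
  orthogonal to \<open>x - y\<close>.\<close>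

lemma laplace_arg_min_unique:
  fixes S :: "(real ^ 'd) set"
  assumes "finite S" and i: "\<not> (\<exists>H. linear_hyperplane H \<and> S \<subseteq> H)"
    and x: "is_arg_min (laplace S) (\<lambda>y. y \<in> orthant) x"
    and y: "is_arg_min (laplace S) (\<lambda>y. y \<in> orthant) y"
  shows "x = y"
proof (rule ccontr)
  assume "x \<noteq> y"
  then have "linear_hyperplane {s. (x - y) \<bullet> s = 0}"
    unfolding linear_hyperplane_def by (intro exI[of _ "x - y"]) auto
  with i obtain s where s: "s \<in> S" "x \<bullet> s \<noteq> y \<bullet> s"
    by (auto simp: inner_diff_left)
  let ?m = "(1/2) *\<^sub>R (x + y)"
  (* the defect in the convexity inequality is an explicit square *)
  have sq: "2 * exp (?m \<bullet> s) = exp (x \<bullet> s) + exp (y \<bullet> s) - (exp (x \<bullet> s / 2) - exp (y \<bullet> s / 2))\<^sup>2" for s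
  proof -
    have "exp (a / 2) ^ 2 = exp a" for a :: real
      by (simp flip: exp_double)
    moreover have "exp (?m \<bullet> s) = exp (x \<bullet> s / 2) * exp (y \<bullet> s / 2)"
      by (simp add: inner_add_left add_divide_distrib flip: exp_add)
    ultimately show ?thesis by (simp add: power2_diff)
  qed
  have le: "2 * exp (?m \<bullet> s) \<le> exp (x \<bullet> s) + exp (y \<bullet> s)" for s
    unfolding sq by simp
  have lt: "2 * exp (?m \<bullet> s) < exp (x \<bullet> s) + exp (y \<bullet> s)"
    unfolding sq using s(2) by simp
  have "(\<Sum>s\<in>S. 2 * exp (?m \<bullet> s)) < (\<Sum>s\<in>S. exp (x \<bullet> s) + exp (y \<bullet> s))"
    using s(1) lt by (intro sum_strict_mono_ex1 assms(1) ballI le) blast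
  then have "2 * laplace S ?m < laplace S x + laplace S y"
    unfolding laplace_def by (simp add: sum.distrib sum_distrib_left)
  moreover have "?m \<in> orthant"
    using x y by (intro orthant_scaleR orthant_add) (auto simp: is_arg_min_def)
  then have "laplace S x \<le> laplace S ?m" "laplace S y \<le> laplace S ?m"
    using x y by (auto simp: is_arg_min_def not_less)
  ultimately show False by linarith
qed

section \<open>Concatenating confined walks\<close>

lemma finite_confined_walks: "finite S \<Longrightarrow> finite (confined_walks S x n)"
  by (rule finite_subset[OF _ finite_words[of S n]]) (auto simp: confined_walks_def words_def)

lemma confined_walks_mono:
  assumes "q \<in> orthant"
  shows "confined_walks S x n \<subseteq> confined_walks S (x + q) n"
proof -
  have "x + q + y \<in> orthant" if "x + y \<in> orthant" for y
    using orthant_add[OF that assms] by (simp add: ac_simps)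
  then show ?thesis by (auto simp: confined_walks_def)
qed

lemma confined_walks_append:
  assumes a: "a \<in> confined_walks S x p" and w: "w \<in> confined_walks S (x + sum_list a) n"
  shows "a @ w \<in> confined_walks S x (p + n)"
proof -
  have "x + sum_list (take k (a @ w)) \<in> orthant" if "k \<in> {1..p + n}" for k
  proof (cases "k \<le> p")
    case True
    then show ?thesis using a that by (auto simp: confined_walks_def)
  next
    case False
    then have "k - p \<in> {1..n}" using that by auto
    then have "x + sum_list a + sum_list (take (k - p) w) \<in> orthant"
      using w by (auto simp: confined_walks_def)
    then show ?thesis using a False by (simp add: confined_walks_def add.assoc)
  qed
  then show ?thesis using a w by (auto simp: confined_walks_def)
qed

lemma confined_walks_take:
  assumes "w \<in> confined_walks S x n" and "r \<le> n"
  shows "take r w \<in> confined_walks S x r"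
  using assms set_take_subset[of r w] by (auto simp: confined_walks_def min_def)

text \<open>The number of pairs is counted by concatenation, which is injective since all words of \<open>B\<close> have
  the same length.\<close>

lemma num_walks_append:
  assumes "finite S" and B: "B \<subseteq> confined_walks S x p"
    and C: "\<And>a. a \<in> B \<Longrightarrow> C \<subseteq> confined_walks S (x + sum_list a) n"
  shows "card B * card C \<le> num_walks S x (p + n)"
proof -
  have "inj_on (\<lambda>(a, w). a @ w) (B \<times> C)"
    using B by (auto simp: inj_on_def confined_walks_def subset_eq)
  then have "card (B \<times> C) = card ((\<lambda>(a, w). a @ w) ` (B \<times> C))"
    by (simp add: card_image)
  also have "\<dots> \<le> num_walks S x (p + n)"
    unfolding num_walks_def using B C
    by (intro card_mono finite_confined_walks assms) (auto intro!: confined_walks_append)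
  finally show ?thesis by (simp add: card_cartesian_product)
qed

text \<open>Once \<open>w\<close> is confined from \<open>x\<close>, it is confined from every later point as well, since its sum
  moves the walk further into the orthant.\<close>

lemma num_walks_repeat:
  assumes "finite S" and w: "w \<in> confined_walks S x p" and q: "sum_list w \<in> orthant"
  shows "num_walks S (x + real r *\<^sub>R sum_list w) n \<le> num_walks S x (r * p + n)"
  using w
proof (induction r arbitrary: x)
  case 0
  show ?case by simp
next
  case (Suc r)
  have "num_walks S (x + sum_list w + real r *\<^sub>R sum_list w) n
      \<le> num_walks S (x + sum_list w) (r * p + n)"
    using confined_walks_mono[OF q] Suc.prems by (intro Suc.IH) blast
  also have "\<dots> \<le> num_walks S x (p + (r * p + n))"
    using num_walks_append[of S "{w}" x p "confined_walks S (x + sum_list w) (r * p + n)" "r * p + n"]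
      assms(1) Suc.prems by (simp add: num_walks_def)
  finally show ?case by (simp add: algebra_simps)
qed

text \<open>After one block the starting point has moved by a vector of the orthant, so all blocks are again
  confined. The last \<open>n mod k\<close> steps are taken from a truncated block.\<close>

lemma num_walks_blocks:
  assumes "finite S" and B: "B \<subseteq> confined_walks S x k" "B \<noteq> {}" "k > 0"
    and q: "\<And>w. w \<in> B \<Longrightarrow> sum_list w \<in> orthant"
  shows "card B ^ (n div k) \<le> num_walks S x n"
proof -
  have step: "card B * num_walks S x n \<le> num_walks S x (k + n)" for n
    unfolding num_walks_def[of S x n]
    by (intro num_walks_append assms confined_walks_mono)
  have blocks: "card B ^ N * num_walks S x r \<le> num_walks S x (N * k + r)" for N r
  proof (induction N)
    case (Suc N)
    have "card B ^ Suc N * num_walks S x r \<le> card B * num_walks S x (N * k + r)"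
      using Suc by simp
    also have "\<dots> \<le> num_walks S x (Suc N * k + r)"
      using step[of "N * k + r"] by (simp add: ac_simps)
    finally show ?case .
  qed simp
  obtain w where "w \<in> B" using B by blast
  then have "take (n mod k) w \<in> confined_walks S x (n mod k)"
    using B by (intro confined_walks_take) (auto simp: less_imp_le)
  then have "1 \<le> num_walks S x (n mod k)"
    unfolding num_walks_def
    by (metis card_0_eq empty_iff finite_confined_walks[OF assms(1)] less_one not_less)
  then have "card B ^ (n div k) \<le> card B ^ (n div k) * num_walks S x (n mod k)"
    by simp
  also have "\<dots> \<le> num_walks S x n"
    using blocks[of "n div k" "n mod k"] by simp
  finally show ?thesis .
qed

section \<open>Growth rate of the number of walks\<close>

text \<open>The endpoint of a confined walk lies in the orthant, hence has nonnegative inner product with \<open>z\<close>: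
  each confined walk contributes at least 1 to the sum of \<open>exp (z \<bullet> endpoint)\<close> over all walks.
  The empty walk is excluded because it does not require \<open>x\<close> to be in the orthant.\<close>

lemma num_walks_le:
  fixes S :: "(real ^ 'd) set"
  assumes "finite S" "z \<in> orthant" "n > 0"
  shows "real (num_walks S x n) \<le> exp (z \<bullet> x) * laplace S z ^ n"
proof -
  have "1 \<le> exp (z \<bullet> x) * exp (z \<bullet> sum_list w)" if "w \<in> confined_walks S x n" for w
  proof -
    have "n \<in> {1..n}" using \<open>n > 0\<close> by simp
    then have "x + sum_list (take n w) \<in> orthant" "length w = n"
      using that unfolding confined_walks_def by blast+
    then show ?thesis
      using inner_orthant_nonneg[OF assms(2), of "x + sum_list w"]
      by (simp add: inner_add_right flip: exp_add)
  qed
  then have "real (num_walks S x n) \<le> (\<Sum>w\<in>confined_walks S x n. exp (z \<bullet> x) * exp (z \<bullet> sum_list w))"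
    unfolding num_walks_def using sum_mono[of "confined_walks S x n" "\<lambda>_. 1 :: real"] by simp
  also have "\<dots> \<le> (\<Sum>w\<in>words S n. exp (z \<bullet> x) * exp (z \<bullet> sum_list w))"
    by (intro sum_mono2 finite_words assms) (auto simp: confined_walks_def words_def)
  also have "\<dots> = exp (z \<bullet> x) * laplace S z ^ n"
    using sum_words_prod_list[of "\<lambda>s. exp (z \<bullet> s)" S n] prod_list_exp_inner[of z 1]
    by (simp add: laplace_def flip: sum_distrib_left)
  finally show ?thesis .
qed

text \<open>The steps are drawn with the exponential tilt at a minimum point \<open>z\<close> of the perturbed Laplace
  transform, for which the drift \<open>m\<close> has positive coordinates while \<open>z \<bullet> m\<close> is small. A typical word
  has probability at most \<open>exp (k * \<epsilon> / 2) / L ^ k\<close>, and typical words have total probability at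
  least 1/2.\<close>

lemma many_blocks:
  fixes S :: "(real ^ 'd) set"
  assumes fin: "finite S" and ii: "\<not> (\<exists>u \<in> orthant - {0}. S \<subseteq> neg_half_space u)"
    and l: "0 < l" "\<And>y. y \<in> orthant \<Longrightarrow> l \<le> laplace S y" and "\<epsilon> > 0"
  shows "\<exists>k>0. \<exists>B\<subseteq>words S k. (\<forall>w\<in>B. \<forall>i. 0 < sum_list w $ i)
      \<and> (l * exp (- \<epsilon>)) ^ k \<le> real (card B)"
proof -
  obtain c where c: "c > 0" "\<And>z. z \<in> orthant \<Longrightarrow> c * norm z \<le> laplace S z"
    using laplace_linear_growth[OF fin ii] by blast
  define R where "R = 2 * real (card S) / c"
  have R: "R \<ge> 0" using c by (simp add: R_def)
  define one :: "real ^ 'd" where "one = (\<chi> i. 1)"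
  define K where "K = (R * norm one + R) / l"
  have K: "K \<ge> 0" using R l by (simp add: K_def)
  (* the first bound on \<eta> keeps the perturbed function coercive, the second one makes z \<bullet> m small *)
  define \<eta> where "\<eta> = min (c / 2 / (norm one + 1)) (\<epsilon> / 2 / (K + 1))"
  have \<eta>: "\<eta> > 0" using c \<open>\<epsilon> > 0\<close> K by (simp add: \<eta>_def add_nonneg_pos)
  have "\<eta> * norm one \<le> \<eta> * (norm one + 1)" using \<eta> by simp
  also have "\<dots> \<le> c / 2"
    using min.cobounded1[of "c / 2 / (norm one + 1)" "\<epsilon> / 2 / (K + 1)"] norm_ge_zero[of one]
    by (simp only: \<eta>_def[symmetric]) (simp add: pos_le_divide_eq add_nonneg_pos algebra_simps)
  finally have \<eta>c: "norm (\<eta> *\<^sub>R one) \<le> c / 2" using \<eta> by simp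
  have "K * \<eta> \<le> (K + 1) * \<eta>" using \<eta> by simp
  also have "\<dots> \<le> \<epsilon> / 2"
    using min.cobounded2[of "c / 2 / (norm one + 1)" "\<epsilon> / 2 / (K + 1)"] K
    by (simp only: \<eta>_def[symmetric]) (simp add: pos_le_divide_eq add_nonneg_pos algebra_simps)
  finally have \<eta>K: "K * \<eta> \<le> \<epsilon> / 2" .
  obtain z where z: "z \<in> orthant" "norm z \<le> R"
    and zmin: "\<And>y. y \<in> orthant \<Longrightarrow> laplace S z - (\<eta> *\<^sub>R one) \<bullet> z \<le> laplace S y - (\<eta> *\<^sub>R one) \<bullet> y"
    using tilted_laplace_has_minimum[OF c \<eta>c] unfolding R_def by blast
  define L where "L = laplace S z"
  have L: "l \<le> L" "0 < L" using l z by (auto simp: L_def intro: less_le_trans)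
  define p where "p s = exp (z \<bullet> s) / L" for s
  define m where "m = laplace_grad S z /\<^sub>R L"
  have p: "sum p S = 1" "\<And>s. 0 \<le> p s"
    using L by (auto simp: p_def L_def laplace_def simp flip: sum_divide_distrib)
  have m: "(\<Sum>s\<in>S. p s *\<^sub>R s) = m"
    by (simp add: m_def p_def laplace_grad_def scaleR_sum_right divide_inverse mult.commute)
  have mi: "\<eta> / L \<le> m $ i" for i
  proof -
    have "z + t *\<^sub>R axis i 1 \<in> orthant" if "0 < t" for t
      using that by (intro orthant_add orthant_scaleR z) (auto simp: orthant_def axis_def)
    from laplace_grad_variational[OF zmin this]
    have "\<eta> \<le> laplace_grad S z $ i" by (simp add: inner_axis one_def)
    then show ?thesis using L by (simp add: m_def divide_inverse mult.commute)
  qed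
  (* a deviation of at most k r leaves the coordinates of k m positive *)
  define r where "r = \<eta> / L / 2"
  have "0 < \<eta> / L" using \<eta> L by simp
  then have r: "r > 0" "r < \<eta> / L" by (simp_all add: r_def)
  have zm: "z \<bullet> m + norm z * r \<le> \<epsilon> / 2"
  proof -
    have "z + t *\<^sub>R (- z) \<in> orthant" if "t < 1" for t
      using orthant_scaleR[OF _ z(1), of "1 - t"] that by (simp add: algebra_simps)
    from laplace_grad_variational[OF zmin this]
    have "z \<bullet> laplace_grad S z \<le> \<eta> * (z \<bullet> one)" by (simp add: inner_commute)
    also have "\<dots> \<le> \<eta> * (R * norm one)"
      using \<eta> order_trans[OF norm_cauchy_schwarz mult_right_mono[OF z(2)], of one]
      by (intro mult_left_mono) (auto simp: less_imp_le)
    finally have "z \<bullet> m \<le> \<eta> * (R * norm one) / L"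
      using L by (simp add: m_def divide_inverse mult.commute)
    moreover have "norm z * r \<le> R * (\<eta> / L)"
      using z R r by (intro mult_mono) auto
    ultimately have "z \<bullet> m + norm z * r \<le> \<eta> * (R * norm one + R) / L"
      by (simp add: algebra_simps add_divide_distrib)
    also have "\<dots> \<le> \<eta> * (R * norm one + R) / l"
      using L l R \<eta> by (intro divide_left_mono) auto
    also have "\<dots> = K * \<eta>" by (simp add: K_def)
    finally show ?thesis using \<eta>K by linarith
  qed
  (* such k absorb the factor 1/2 of the weak law into exp (k * \<epsilon> / 2) *)
  have "\<forall>\<^sub>F k in sequentially. 2 * ln 2 / \<epsilon> \<le> real k"
    by (meson eventually_sequentiallyI le_nat_iff nat_ceiling_le_eq)
  with words_weak_law[OF fin p(2) p(1) m r(1)]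
  have "\<forall>\<^sub>F k in sequentially. 2 * ln 2 / \<epsilon> \<le> real k \<and> 0 < k \<and>
    1/2 \<le> (\<Sum>w\<in>{w \<in> words S k. norm (sum_list w - real k *\<^sub>R m) \<le> real k * r}. prod_list (map p w))"
    by (intro eventually_conj eventually_gt_at_top)
  then obtain k where k: "2 * ln 2 / \<epsilon> \<le> real k" "0 < k" and half:
    "1/2 \<le> (\<Sum>w\<in>{w \<in> words S k. norm (sum_list w - real k *\<^sub>R m) \<le> real k * r}. prod_list (map p w))"
    using eventually_happens'[OF sequentially_bot] by blast
  define B where "B = {w \<in> words S k. norm (sum_list w - real k *\<^sub>R m) \<le> real k * r}"
  have "0 < sum_list w $ i" if "w \<in> B" for w i
  proof -
    have "\<bar>(sum_list w - real k *\<^sub>R m) $ i\<bar> \<le> real k * r"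
      using that component_le_norm_cart[of "sum_list w - real k *\<^sub>R m" i] by (simp add: B_def)
    moreover have "real k * r < real k * m $ i"
      using k(2) less_le_trans[OF r(2) mi[of i]] by (intro mult_strict_left_mono) auto
    ultimately show ?thesis by simp
  qed
  moreover have "(l * exp (- \<epsilon>)) ^ k \<le> real (card B)"
  proof -
    have "prod_list (map p w) \<le> exp (real k * (\<epsilon> / 2)) / L ^ k" if "w \<in> B" for w
    proof -
      have "z \<bullet> (sum_list w - real k *\<^sub>R m) \<le> norm z * (real k * r)"
        using that by (intro order_trans[OF norm_cauchy_schwarz] mult_left_mono) (auto simp: B_def)
      then have "z \<bullet> sum_list w \<le> real k * (z \<bullet> m + norm z * r)"
        by (simp add: inner_diff_right algebra_simps)
      also have "\<dots> \<le> real k * (\<epsilon> / 2)"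
        by (intro mult_left_mono zm) auto
      finally show ?thesis
        using that L unfolding p_def prod_list_exp_inner
        by (auto simp: B_def words_def intro!: divide_right_mono)
    qed
    then have "(\<Sum>w\<in>B. prod_list (map p w)) \<le> real (card B) * (exp (real k * (\<epsilon> / 2)) / L ^ k)"
      by (rule sum_bounded_above)
    then have "1/2 \<le> real (card B) * (exp (real k * (\<epsilon> / 2)) / L ^ k)"
      using half unfolding B_def by linarith
    then have "L ^ k \<le> real (card B) * (2 * exp (real k * (\<epsilon> / 2)))"
      using L by (simp add: field_simps)
    also have "\<dots> \<le> real (card B) * (exp (real k * (\<epsilon> / 2)) * exp (real k * (\<epsilon> / 2)))"
    proof -
      have "ln 2 \<le> real k * (\<epsilon> / 2)" using k \<open>\<epsilon> > 0\<close> by (simp add: field_simps)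
      then have "exp (ln 2) \<le> exp (real k * (\<epsilon> / 2))" by (simp only: exp_le_cancel_iff)
      then have "2 \<le> exp (real k * (\<epsilon> / 2))" by simp
      then show ?thesis by (intro mult_left_mono mult_right_mono) auto
    qed
    also have "\<dots> = real (card B) * exp \<epsilon> ^ k"
      by (simp flip: exp_add exp_of_nat_mult)
    finally have "L ^ k * exp (- \<epsilon>) ^ k \<le> real (card B)"
      by (simp add: exp_minus field_simps)
    moreover have "(l * exp (- \<epsilon>)) ^ k \<le> (L * exp (- \<epsilon>)) ^ k"
      using L l by (intro power_mono mult_right_mono) auto
    ultimately show ?thesis unfolding power_mult_distrib by linarith
  qed
  moreover have "B \<subseteq> words S k" by (auto simp: B_def)
  ultimately show ?thesis using k by blast
qed

text \<open>A finite set of words has finitely many prefix sums, and a large multiple of \<open>v\<close> moves all of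
  them into the orthant.\<close>

lemma blocks_confined:
  fixes S :: "(real ^ 'd) set"
  assumes "finite S" and B: "B \<subseteq> words S k" and v: "\<And>i. 0 < v $ i"
  shows "\<exists>D\<ge>0. \<forall>t\<ge>D. \<forall>q\<in>orthant. B \<subseteq> confined_walks S (q + t *\<^sub>R v) k"
proof -
  let ?A = "\<Union>w\<in>B. (\<lambda>j. sum_list (take j w)) ` {..k}"
  have "finite ?A"
    using finite_subset[OF B finite_words[OF assms(1)]] by simp
  then obtain D where D: "D \<ge> 0" "\<And>a t. a \<in> ?A \<Longrightarrow> t \<ge> D \<Longrightarrow> a + t *\<^sub>R v \<in> orthant"
    using positive_direction_absorbs[OF v, of ?A] by blast
  have "w \<in> confined_walks S (q + t *\<^sub>R v) k" if "w \<in> B" "t \<ge> D" "q \<in> orthant" for w t q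
  proof -
    have "q + (sum_list (take j w) + t *\<^sub>R v) \<in> orthant" if "j \<in> {1..k}" for j
      using that \<open>w \<in> B\<close> by (intro orthant_add \<open>q \<in> orthant\<close> D(2) \<open>t \<ge> D\<close>) auto
    then show ?thesis
      using B \<open>w \<in> B\<close> by (auto simp: words_def confined_walks_def algebra_simps)
  qed
  then show ?thesis using D(1) by blast
qed

lemma root_power_div_tendsto:
  assumes "k > 0" "M > 0"
  shows "(\<lambda>n. root n (M ^ ((n - n0) div k))) \<longlonglongrightarrow> root k M"
proof -
  have lo: "1 / real k - (real n0 / real k + 1) / real n \<le> real ((n - n0) div k) / real n"
    if "n > 0" for n
  proof -
    have "n - n0 \<le> k * ((n - n0) div k) + k"
      using mult_div_mod_eq[of k "n - n0"] mod_less_divisor[OF assms(1), of "n - n0"] by linarith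
    then have "n \<le> k * ((n - n0) div k) + k + n0" by linarith
    then have "real n \<le> real k * real ((n - n0) div k) + real k + real n0"
      by (metis of_nat_add of_nat_le_iff of_nat_mult)
    then have "real n / real n / real k
        \<le> (real k * real ((n - n0) div k) + real k + real n0) / real n / real k"
      by (intro divide_right_mono) auto
    then show ?thesis using that assms(1) by (simp add: add_divide_distrib algebra_simps)
  qed
  have hi: "real ((n - n0) div k) / real n \<le> 1 / real k" if "n > 0" for n
  proof -
    have "k * ((n - n0) div k) \<le> n"
      using times_div_less_eq_dividend[of k "n - n0"] by linarith
    then have "real k * real ((n - n0) div k) \<le> real n"
      by (metis of_nat_le_iff of_nat_mult)
    then show ?thesis using that assms(1) by (simp add: field_simps)
  qed
  have "(\<lambda>n. real ((n - n0) div k) / real n) \<longlonglongrightarrow> 1 / real k"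
  proof (rule tendsto_sandwich)
    show "(\<lambda>n. 1 / real k - (real n0 / real k + 1) / real n) \<longlonglongrightarrow> 1 / real k"
      using tendsto_diff[OF tendsto_const lim_const_over_n] by fastforce
    show "\<forall>\<^sub>F n in sequentially. 1 / real k - (real n0 / real k + 1) / real n
        \<le> real ((n - n0) div k) / real n"
      using eventually_gt_at_top[of 0] by eventually_elim (rule lo)
    show "\<forall>\<^sub>F n in sequentially. real ((n - n0) div k) / real n \<le> 1 / real k"
      using eventually_gt_at_top[of 0] by eventually_elim (rule hi)
  qed (rule tendsto_const)
  then have "(\<lambda>n. M powr (real ((n - n0) div k) / real n)) \<longlonglongrightarrow> M powr (1 / real k)"
    using assms by (intro tendsto_powr tendsto_const) auto
  moreover have "\<forall>\<^sub>F n in sequentially. M powr (real ((n - n0) div k) / real n)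
      = root n (M ^ ((n - n0) div k))"
    using eventually_gt_at_top[of 0]
    by eventually_elim (use assms in \<open>simp add: root_powr_inverse powr_powr flip: powr_realpow\<close>)
  ultimately show ?thesis
    using assms by (simp add: root_powr_inverse tendsto_cong)
qed

text \<open>The blocks that beat \<open>a\<close> require a depth that depends on \<open>a\<close>. The walk reaches it with \<open>r\<close> copies of
  the fixed word \<open>w\<close>, and these \<open>r * p\<close> steps are lost only once.\<close>

lemma num_walks_root_lower:
  fixes S :: "(real ^ 'd) set"
  assumes fin: "finite S" and ii: "\<not> (\<exists>u \<in> orthant - {0}. S \<subseteq> neg_half_space u)"
    and l: "0 < l" "\<And>y. y \<in> orthant \<Longrightarrow> l \<le> laplace S y"
    and w: "w \<in> confined_walks S x p" "\<And>i. 0 < sum_list w $ i" and x: "x \<in> orthant"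
    and a: "a < l"
  shows "\<forall>\<^sub>F n in sequentially. a < root n (real (num_walks S x n))"
proof -
  (* for a > 0 this makes l * exp (- \<epsilon>) the geometric mean of a and l *)
  define \<epsilon> where "\<epsilon> = (if a > 0 then ln (l / a) / 2 else 1)"
  have \<epsilon>: "\<epsilon> > 0" using a l by (simp add: \<epsilon>_def)
  have a\<epsilon>: "a < l * exp (- \<epsilon>)"
  proof (cases "a > 0")
    case True
    then have "exp \<epsilon> < exp (ln (l / a))"
      using \<epsilon> by (simp only: exp_less_cancel_iff) (simp add: \<epsilon>_def)
    then show ?thesis using True l by (simp add: exp_minus field_simps)
  next
    case False
    then show ?thesis using l by (simp add: le_less_trans[of a 0])
  qed
  obtain k B where k: "k > 0" and B: "B \<subseteq> words S k" "\<And>b i. b \<in> B \<Longrightarrow> 0 < sum_list b $ i"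
      "(l * exp (- \<epsilon>)) ^ k \<le> real (card B)"
    using many_blocks[OF fin ii l \<epsilon>] by blast
  have "0 < (l * exp (- \<epsilon>)) ^ k" using l by simp
  with B(3) have cB: "0 < real (card B)" by linarith
  obtain D where D: "\<And>t. t \<ge> D \<Longrightarrow> B \<subseteq> confined_walks S (x + t *\<^sub>R sum_list w) k"
    using blocks_confined[OF fin B(1) w(2)] x by blast
  obtain r where r: "D \<le> real r" using real_arch_simple by blast
  have posi: "u \<in> orthant" if "\<And>i. 0 < u $ i" for u :: "real ^ 'd"
    using that by (simp add: orthant_def less_imp_le)
  have lower: "card B ^ ((n - r * p) div k) \<le> num_walks S x n" if "r * p \<le> n" for n
  proof -
    have "card B ^ ((n - r * p) div k) \<le> num_walks S (x + real r *\<^sub>R sum_list w) (n - r * p)"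
      using cB by (intro num_walks_blocks fin D r k posi B(2)) auto
    also have "\<dots> \<le> num_walks S x (r * p + (n - r * p))"
      by (intro num_walks_repeat fin w posi)
    finally show ?thesis using that by simp
  qed
  have "l * exp (- \<epsilon>) \<le> root k (real (card B))"
    using real_root_le_mono[OF k B(3)] k l by (simp add: real_root_power_cancel)
  with a\<epsilon> have "a < root k (real (card B))" by linarith
  from order_tendstoD(1)[OF root_power_div_tendsto[OF k cB, of "r * p"] this]
  show ?thesis using eventually_ge_at_top[of "r * p"] eventually_gt_at_top[of 0]
  proof eventually_elim
    case (elim n)
    have "real (card B) ^ ((n - r * p) div k) \<le> real (num_walks S x n)"
      using lower[OF elim(2)] by (metis of_nat_le_iff of_nat_power)
    then show ?case using elim(1) real_root_le_mono[OF elim(3)] by (meson less_le_trans)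
  qed
qed

theorem corollary8:
  fixes S :: "(real ^ 'd) set" and v :: "real ^ 'd"
  assumes "v \<in> interior orthant"
    and "finite S"
    and "\<not> (\<exists>H. linear_hyperplane H \<and> S \<subseteq> H)"
    and "\<not> (\<exists>u \<in> orthant - {0}. S \<subseteq> neg_half_space u)"
  shows "\<exists>x0. is_arg_min (laplace S) (\<lambda>y. y \<in> orthant) x0
    \<and> (\<forall>y. is_arg_min (laplace S) (\<lambda>z. z \<in> orthant) y \<longrightarrow> y = x0)
    \<and> (\<exists>\<delta>\<ge>0. \<forall>x \<in> shifted_orthant v \<delta>.
          (\<lambda>n. root n (real (num_walks S x n))) \<longlonglongrightarrow> laplace S x0)"
proof -
  obtain c where c: "c > 0" "\<And>z. z \<in> orthant \<Longrightarrow> c * norm z \<le> laplace S z"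
    using laplace_linear_growth[OF assms(2,4)] by blast
  obtain x0 where x0: "x0 \<in> orthant" "\<And>y. y \<in> orthant \<Longrightarrow> laplace S x0 \<le> laplace S y"
    using tilted_laplace_has_minimum[OF c, of 0] c(1) by auto
  have min: "is_arg_min (laplace S) (\<lambda>y. y \<in> orthant) x0"
    using x0 by (auto simp: is_arg_min_def not_less)
  have "S \<noteq> {}"
  proof
    assume "S = {}"
    moreover have "linear_hyperplane {y :: real ^ 'd. axis undefined 1 \<bullet> y = 0}"
      unfolding linear_hyperplane_def by (intro exI[of _ "axis undefined 1"]) (auto simp: axis_eq_0_iff)
    ultimately show False using assms(3) by blast
  qed
  then have pos: "0 < laplace S x0"
    unfolding laplace_def by (intro sum_pos assms) auto
  (* only one block is needed to fix \<delta>; the precision 1 is arbitrary *)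
  obtain k B where B: "B \<subseteq> words S k" "\<And>b i. b \<in> B \<Longrightarrow> 0 < sum_list b $ i"
      "(laplace S x0 * exp (- 1)) ^ k \<le> real (card B)"
    using many_blocks[OF assms(2,4) pos x0(2), of 1] by auto
  have "0 < (laplace S x0 * exp (- 1)) ^ k" using pos by simp
  with B(3) have "B \<noteq> {}" by auto
  then obtain w where w: "w \<in> B" by blast
  have v: "0 < v $ i" for i by (rule interior_orthant_component_pos[OF assms(1)])
  obtain \<delta> where \<delta>: "\<delta> \<ge> 0" "\<And>q. q \<in> orthant \<Longrightarrow> B \<subseteq> confined_walks S (q + \<delta> *\<^sub>R v) k"
    using blocks_confined[OF assms(2) B(1) v] by blast
  have "(\<lambda>n. root n (real (num_walks S x n))) \<longlonglongrightarrow> laplace S x0" if x: "x \<in> shifted_orthant v \<delta>" for x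
  proof (rule order_tendstoI)
    obtain q where q: "q \<in> orthant" "x = q + \<delta> *\<^sub>R v"
      using x by (auto simp: shifted_orthant_def)
    have "\<delta> *\<^sub>R v \<in> orthant" using \<delta>(1) v by (simp add: orthant_def less_imp_le)
    then have "x \<in> orthant" using q by (simp add: orthant_add)
    then show "\<forall>\<^sub>F n in sequentially. a < root n (real (num_walks S x n))" if "a < laplace S x0" for a
      using \<delta>(2)[OF q(1)] w that q(2)
      by (intro num_walks_root_lower[OF assms(2,4) pos x0(2) _ B(2)[OF w]]) auto
  next
    fix a assume a: "laplace S x0 < a"
    have "(\<lambda>n. root n (exp (x0 \<bullet> x)) * laplace S x0) \<longlonglongrightarrow> 1 * laplace S x0"
      by (intro tendsto_mult LIMSEQ_root_const tendsto_const) auto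
    from order_tendstoD(2)[OF this, of a] a
    have "\<forall>\<^sub>F n in sequentially. root n (exp (x0 \<bullet> x)) * laplace S x0 < a" by simp
    then show "\<forall>\<^sub>F n in sequentially. root n (real (num_walks S x n)) < a"
      using eventually_gt_at_top[of 0]
    proof eventually_elim
      case (elim n)
      have "root n (real (num_walks S x n)) \<le> root n (exp (x0 \<bullet> x) * laplace S x0 ^ n)"
        using elim(2) by (intro real_root_le_mono num_walks_le assms x0)
      also have "\<dots> = root n (exp (x0 \<bullet> x)) * laplace S x0"
        using elim(2) pos by (simp add: real_root_mult real_root_power_cancel)
      finally show ?case using elim(1) by linarith
    qed
  qed
  then show ?thesis
    using min laplace_arg_min_unique[OF assms(2,3)] \<delta>(1) by blast
qed

end
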